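(* Let $N(D_6^4)$ be the Niemeier lattice with root lattice $D_6^4$. The two primitive embeddings of $A_5\oplus A_1$ in $N(D_6^4)$ given by $(i_1(A_5),d_6,0,0)$ and $(i_2(A_5),d_5,0,0)$ are isomorphic by an element of $\mathrm{Aut}(N(D_6^4))$; that is, there is an element of $\mathrm{Aut}(N(D_6^4))$ carrying one embedding to the other. Here $(i(A_5),d,0,0)$ denotes the embedding with $A_5$ embedded by $i$ in the first copy of $D_6$ and $A_1$ embedded as $\langle d\rangle$ in the second copy of $D_6$.
   Context: Root lattices are negative definite (roots have square $-2$). $d_1,\dots,d_6$ are the simple roots of $D_6$ in Bourbaki numbering: chain $d_1-d_2-d_3-d_4$, with $d_5$ and $d_6$ both joined to $d_4$. The embeddings $i_1,i_2:A_5\to D_6$ send the consecutive simple roots of $A_5$ to $i_1(A_5)=(d_5,d_4,d_3,d_2,d_1)$ and $i_2(A_5)=(d_6,d_4,d_3,d_2,d_1)$ respectively. Glue vectors of $D_6$: $[0]=0$, $[1]=\frac12(d_1+2d_2+3d_3+4d_4+2d_5+3d_6)$, $[2]=d_1+d_2+d_3+d_4+\frac12(d_5+d_6)$, $[3]=\frac12(d_1+2d_2+3d_3+4d_4+3d_5+2d_6)$, representing $D_6^*/D_6$. The Niemeier lattice $N(D_6^4)\subset (D_6^* )^4$ is generated by $D_6\oplus D_6\oplus D_6\oplus D_6$ and the glue code consisting of the 16 vectors $[0,0,0,0],[1,1,1,1],[2,2,2,2],[3,3,3,3]$ and all even permutations of $[0,1,2,3]$ (an entry $i$ stands for $[i]$).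 *)

theory Defs
  imports
    "HOL-Analysis.Analysis"
    "HOL-Combinatorics.Permutations"
    "HOL-Computational_Algebra.Group_Closure"
begin

text \<open>
  A lattice is given by an additive subgroup \<open>L\<close> of a real vector space together with a bilinear
  form \<open>b\<close> on that space. Maps between lattices are total functions on the ambient spaces, but
  only their values on the lattice matter.
\<close>

definition lattice_embedding ::
  "'a::real_vector set \<Rightarrow> ('a \<Rightarrow> 'a \<Rightarrow> real) \<Rightarrow> 'b::real_vector set \<Rightarrow> ('b \<Rightarrow> 'b \<Rightarrow> real) \<Rightarrow> ('a \<Rightarrow> 'b) \<Rightarrow> bool"
  where "lattice_embedding L b M c f \<longleftrightarrow>
    f ` L \<subseteq> M \<and> inj_on f L \<and>
    (\<forall>x\<in>L. \<forall>y\<in>L. f (x + y) = f x + f y) \<and>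
    (\<forall>x\<in>L. \<forall>y\<in>L. c (f x) (f y) = b x y)"

text \<open>Primitive: the quotient of \<open>M\<close> by the image is torsion-free.\<close>

definition primitive_embedding ::
  "'a::real_vector set \<Rightarrow> ('a \<Rightarrow> 'a \<Rightarrow> real) \<Rightarrow> 'b::real_vector set \<Rightarrow> ('b \<Rightarrow> 'b \<Rightarrow> real) \<Rightarrow> ('a \<Rightarrow> 'b) \<Rightarrow> bool"
  where "primitive_embedding L b M c f \<longleftrightarrow>
    lattice_embedding L b M c f \<and>
    (\<forall>x\<in>M. \<forall>n::nat. n \<noteq> 0 \<longrightarrow> real n *\<^sub>R x \<in> f ` L \<longrightarrow> x \<in> f ` L)"

definition lattice_Aut :: "'a::real_vector set \<Rightarrow> ('a \<Rightarrow> 'a \<Rightarrow> real) \<Rightarrow> ('a \<Rightarrow> 'a) set"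
  where "lattice_Aut L b = {g. lattice_embedding L b L b g \<and> g ` L = L}"

definition isomorphic_embeddings ::
  "'a::real_vector set \<Rightarrow> 'b::real_vector set \<Rightarrow> ('b \<Rightarrow> 'b \<Rightarrow> real) \<Rightarrow> ('a \<Rightarrow> 'b) \<Rightarrow> ('a \<Rightarrow> 'b) \<Rightarrow> bool"
  where "isomorphic_embeddings L M c f f' \<longleftrightarrow> (\<exists>g\<in>lattice_Aut M c. \<forall>x\<in>L. g (f x) = f' x)"

text \<open>
  Root lattices in coordinates with respect to the simple roots: the lattice consists of the
  vectors with integer coordinates, and the Gram matrix of the simple roots is the negative of
  the (simply laced) Cartan matrix of the Dynkin diagram with edge set \<open>E\<close>.
\<close>

definition int_lattice :: "(real ^ 'n) set"
  where "int_lattice = {x. \<forall>i. x $ i \<in> \<int>}"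

definition dynkin_gram :: "('n \<times> 'n) set \<Rightarrow> real ^ 'n ^ 'n"
  where "dynkin_gram E =
    (\<chi> i j. if i = j then - 2 else if (i, j) \<in> E \<or> (j, i) \<in> E then 1 else 0)"

definition dynkin_form :: "('n::finite \<times> 'n) set \<Rightarrow> real ^ 'n \<Rightarrow> real ^ 'n \<Rightarrow> real"
  where "dynkin_form E x y = x \<bullet> (dynkin_gram E *v y)"

text \<open>
  In the index type \<open>6\<close> the numerals \<open>1, \<dots>, 6\<close> denote the six distinct elements (with \<open>6 = 0\<close>);
  similarly for the index types \<open>4\<close> and \<open>5\<close>.
\<close>

definition A1_form :: "real ^ 1 \<Rightarrow> real ^ 1 \<Rightarrow> real"
  where "A1_form = dynkin_form {}"

definition A5_form :: "real ^ 5 \<Rightarrow> real ^ 5 \<Rightarrow> real"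
  where "A5_form = dynkin_form {(1, 2), (2, 3), (3, 4), (4, 5)}"

definition D6_form :: "real ^ 6 \<Rightarrow> real ^ 6 \<Rightarrow> real"
  where "D6_form = dynkin_form {(1, 2), (2, 3), (3, 4), (4, 5), (4, 6)}"

definition A5_A1 :: "((real ^ 5) \<times> (real ^ 1)) set"
  where "A5_A1 = int_lattice \<times> int_lattice"

definition A5_A1_form :: "(real ^ 5) \<times> (real ^ 1) \<Rightarrow> (real ^ 5) \<times> (real ^ 1) \<Rightarrow> real"
  where "A5_A1_form x y = A5_form (fst x) (fst y) + A1_form (snd x) (snd y)"

definition D6 :: "(real ^ 6) set"
  where "D6 = int_lattice"

definition d :: "6 \<Rightarrow> real ^ 6"
  where "d i = axis i 1"

fun D6_glue :: "nat \<Rightarrow> real ^ 6"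
  where
    "D6_glue (Suc 0) = (1/2) *\<^sub>R (d 1 + 2 *\<^sub>R d 2 + 3 *\<^sub>R d 3 + 4 *\<^sub>R d 4 + 2 *\<^sub>R d 5 + 3 *\<^sub>R d 6)"
  | "D6_glue (Suc (Suc 0)) = d 1 + d 2 + d 3 + d 4 + (1/2) *\<^sub>R (d 5 + d 6)"
  | "D6_glue (Suc (Suc (Suc 0))) =
      (1/2) *\<^sub>R (d 1 + 2 *\<^sub>R d 2 + 3 *\<^sub>R d 3 + 4 *\<^sub>R d 4 + 3 *\<^sub>R d 5 + 2 *\<^sub>R d 6)"
  | "D6_glue _ = 0"

definition D6_4_form :: "real ^ 6 ^ 4 \<Rightarrow> real ^ 6 ^ 4 \<Rightarrow> real"
  where "D6_4_form x y = (\<Sum>k\<in>UNIV. D6_form (x $ k) (y $ k))"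

definition glue_code :: "nat list set"
  where "glue_code =
    {[0, 0, 0, 0], [1, 1, 1, 1], [2, 2, 2, 2], [3, 3, 3, 3]} \<union>
    {permute_list p [0, 1, 2, 3] | p. p permutes {..<4} \<and> evenperm p}"

definition N_D6_4 :: "(real ^ 6 ^ 4) set"
  where "N_D6_4 = group_closure
    ({x. \<forall>k. x $ k \<in> D6} \<union> {vector (map D6_glue w) | w. w \<in> glue_code})"

text \<open>The linear map sending the simple roots of \<open>A\<^sub>5\<close> to the vectors \<open>r\<^sub>1, \<dots>, r\<^sub>5\<close>.\<close>

definition A5_map :: "real ^ 6 ^ 5 \<Rightarrow> real ^ 5 \<Rightarrow> real ^ 6"
  where "A5_map r x = (\<Sum>k\<in>UNIV. (x $ k) *\<^sub>R (r $ k))"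

definition i1 :: "real ^ 5 \<Rightarrow> real ^ 6"
  where "i1 = A5_map (vector [d 5, d 4, d 3, d 2, d 1])"

definition i2 :: "real ^ 5 \<Rightarrow> real ^ 6"
  where "i2 = A5_map (vector [d 6, d 4, d 3, d 2, d 1])"

text \<open>The embedding \<open>(i(A\<^sub>5), r, 0, 0)\<close>.\<close>

definition A5_A1_map ::
  "(real ^ 5 \<Rightarrow> real ^ 6) \<Rightarrow> real ^ 6 \<Rightarrow> (real ^ 5) \<times> (real ^ 1) \<Rightarrow> real ^ 6 ^ 4"
  where "A5_A1_map i r x = vector [i (fst x), (snd x $ 1) *\<^sub>R r, 0, 0]"

end

theory Submission
  imports Defs
begin

text \<open>
  Exchange the tails \<open>d\<^sub>5\<close> and \<open>d\<^sub>6\<close> in each of the four copies of \<open>D\<^sub>6\<close>. On glue vectors this exchanges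
  [1] and [3], which turns even permutations of [0,1,2,3] into odd ones; exchanging also the last
  two copies of \<open>D\<^sub>6\<close> restores the parity, so the composite is an automorphism of the Niemeier
  lattice, and it carries the first embedding to the second. The first embedding is primitive
  because no nonzero glue word vanishes in the last two positions.
\<close>

section \<open>Index types, forms and embeddings in coordinates\<close>

lemma exhaust_6:
  fixes x :: 6
  shows "x = 1 \<or> x = 2 \<or> x = 3 \<or> x = 4 \<or> x = 5 \<or> x = 6"
proof (induct x)
  case (of_int z)
  then have "0 \<le> z" and "z < 6" by simp_all
  \<comment> \<open>The representative 0 is the index \<open>6\<close>, so \<open>z = 0\<close>
    yields the last disjunct.\<close>
  then have "z = 0 \<or> z = 1 \<or> z = 2 \<or> z = 3 \<or> z = 4 \<or> z = 5" by arith
  then show ?case by auto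
qed

lemma UNIV_6: "UNIV = {1, 2, 3, 4, 5, 6 :: 6}" using exhaust_6 by auto

lemma sum_6: "sum f (UNIV :: 6 set) = f 1 + f 2 + f 3 + f 4 + f 5 + f 6"
  unfolding UNIV_6 by (simp add: ac_simps)

lemma exhaust_5:
  fixes x :: 5
  shows "x = 1 \<or> x = 2 \<or> x = 3 \<or> x = 4 \<or> x = 5"
proof (induct x)
  case (of_int z)
  then have "0 \<le> z" and "z < 5" by simp_all
  then have "z = 0 \<or> z = 1 \<or> z = 2 \<or> z = 3 \<or> z = 4" by arith
  then show ?case by auto
qed

lemma UNIV_5: "UNIV = {1, 2, 3, 4, 5 :: 5}" using exhaust_5 by auto

lemma sum_5: "sum f (UNIV :: 5 set) = f 1 + f 2 + f 3 + f 4 + f 5"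
  unfolding UNIV_5 by (simp add: ac_simps)

lemma vector_5:
  "(vector [x1,x2,x3,x4,x5] :: 'a::zero ^ 5) $ 1 = x1"
  "(vector [x1,x2,x3,x4,x5] :: 'a::zero ^ 5) $ 2 = x2"
  "(vector [x1,x2,x3,x4,x5] :: 'a::zero ^ 5) $ 3 = x3"
  "(vector [x1,x2,x3,x4,x5] :: 'a::zero ^ 5) $ 4 = x4"
  "(vector [x1,x2,x3,x4,x5] :: 'a::zero ^ 5) $ 5 = x5"
  unfolding vector_def by simp_all

lemma D6_form_eq: "D6_form x y =
   - 2 * (x$1 * y$1 + x$2 * y$2 + x$3 * y$3 + x$4 * y$4 + x$5 * y$5 + x$6 * y$6)
   + (x$1 * y$2 + x$2 * y$1) + (x$2 * y$3 + x$3 * y$2) + (x$3 * y$4 + x$4 * y$3)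
   + (x$4 * y$5 + x$5 * y$4) + (x$4 * y$6 + x$6 * y$4)"
  by (simp add: D6_form_def dynkin_form_def dynkin_gram_def inner_vec_def
      matrix_vector_mult_def sum_6 algebra_simps)

lemma A5_form_eq: "A5_form x y =
   - 2 * (x$1 * y$1 + x$2 * y$2 + x$3 * y$3 + x$4 * y$4 + x$5 * y$5)
   + (x$1 * y$2 + x$2 * y$1) + (x$2 * y$3 + x$3 * y$2) + (x$3 * y$4 + x$4 * y$3)
   + (x$4 * y$5 + x$5 * y$4)"
  by (simp add: A5_form_def dynkin_form_def dynkin_gram_def inner_vec_def
      matrix_vector_mult_def sum_5 algebra_simps)

lemma A1_form_eq: "A1_form x y = - 2 * (x$1 * y$1)"
  by (simp add: A1_form_def dynkin_form_def dynkin_gram_def inner_vec_def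
      matrix_vector_mult_def)

lemma i1_nth: "i1 x $ 1 = x$5" "i1 x $ 2 = x$4" "i1 x $ 3 = x$3" "i1 x $ 4 = x$2" "i1 x $ 5 = x$1" "i1 x $ 6 = 0"
  by (simp_all add: i1_def A5_map_def sum_5 vector_5 d_def axis_def)

lemma i2_nth: "i2 x $ 1 = x$5" "i2 x $ 2 = x$4" "i2 x $ 3 = x$3" "i2 x $ 4 = x$2" "i2 x $ 5 = 0" "i2 x $ 6 = x$1"
  by (simp_all add: i2_def A5_map_def sum_5 vector_5 d_def axis_def)

section \<open>Parity of the permutations of four letters\<close>

definition even_words :: "nat list set" where
  "even_words = {[0,1,2,3], [0,2,3,1], [0,3,1,2], [1,0,3,2], [1,2,0,3], [1,3,2,0],
     [2,0,1,3], [2,1,3,0], [2,3,0,1], [3,0,2,1], [3,1,0,2], [3,2,1,0]}"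

definition odd_words :: "nat list set" where
  "odd_words = {[0,1,3,2], [0,2,1,3], [0,3,2,1], [1,0,2,3], [1,2,3,0], [1,3,0,2],
     [2,0,3,1], [2,1,0,3], [2,3,1,0], [3,0,1,2], [3,1,2,0], [3,2,0,1]}"

text \<open>Exchanging two letters reverses the parity of a word. With both classes listed
  explicitly this is a finite evaluation over all pairs of letters and all 24 words.\<close>

lemma transpose_words:
  assumes "a < 4" "b < 4" "a \<noteq> b"
  shows "w \<in> even_words \<Longrightarrow> map (Transposition.transpose a b) w \<in> odd_words"
    and "w \<in> odd_words \<Longrightarrow> map (Transposition.transpose a b) w \<in> even_words"
proof -
  have ab: "a \<in> {0,1,2,3}" "b \<in> {0,1,2,3}" using assms by auto
  have "\<forall>a\<in>{0,1,2,3}. \<forall>b\<in>{0,1,2,3}. a \<noteq> b \<longrightarrow>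
    (\<forall>w\<in>even_words. map (Transposition.transpose a b) w \<in> odd_words) \<and>
    (\<forall>w\<in>odd_words. map (Transposition.transpose a b) w \<in> even_words)"
    by code_simp
  with ab assms(3)
  show "w \<in> even_words \<Longrightarrow> map (Transposition.transpose a b) w \<in> odd_words"
    and "w \<in> odd_words \<Longrightarrow> map (Transposition.transpose a b) w \<in> even_words"
    by blast+
qed

text \<open>The induction builds \<open>p\<close> from the identity by transpositions acting on the
  values, and each one flips both \<open>evenperm\<close> and the class of the word. Odd
  permutations are included because the induction passes through them.\<close>

lemma permutes_4_words:
  assumes "p permutes {..<4::nat}"
  shows "map p [0,1,2,3] \<in> (if evenperm p then even_words else odd_words)"
  using assms finite_lessThan
proof (induction rule: permutes_induct)
  case id
  then show ?case by (simp add: even_words_def)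
next
  case (swap a b p)
  have "evenperm (Transposition.transpose a b \<circ> p) \<longleftrightarrow> \<not> evenperm p"
    using swap by (subst evenperm_comp) (auto simp: evenperm_swap permutation_swap_id
        intro: permutes_imp_permutation[OF finite_lessThan])
  moreover have "map (Transposition.transpose a b \<circ> p) [0,1,2,3] =
      map (Transposition.transpose a b) (map p [0,1,2,3])"
    by simp
  moreover have "a < 4" "b < 4" using swap by auto
  ultimately show ?case
    using swap.IH \<open>a \<noteq> b\<close> transpose_words[of a b "map p [0,1,2,3]"] by presburger
qed

section \<open>The diagram involution of D_6 and the induced map on four copies\<close>

definition tail_swap :: "real ^ 6 \<Rightarrow> real ^ 6"
  where "tail_swap x = (\<chi> j. x $ Transposition.transpose 5 6 j)"

definition N_swap :: "real ^ 6 ^ 4 \<Rightarrow> real ^ 6 ^ 4"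
  where "N_swap x = vector [tail_swap (x $ 1), tail_swap (x $ 2), tail_swap (x $ 4), tail_swap (x $ 3)]"

lemma vector_4:
  "(vector [x1,x2,x3,x4] :: 'a::zero ^ 4) $ 1 = x1"
  "(vector [x1,x2,x3,x4] :: 'a::zero ^ 4) $ 2 = x2"
  "(vector [x1,x2,x3,x4] :: 'a::zero ^ 4) $ 3 = x3"
  "(vector [x1,x2,x3,x4] :: 'a::zero ^ 4) $ 4 = x4"
  unfolding vector_def by simp_all

lemma forall_6: "(\<forall>i::6. P i) \<longleftrightarrow> P 1 \<and> P 2 \<and> P 3 \<and> P 4 \<and> P 5 \<and> P 6"
  by (metis exhaust_6)

lemma forall_5: "(\<forall>i::5. P i) \<longleftrightarrow> P 1 \<and> P 2 \<and> P 3 \<and> P 4 \<and> P 5"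
  by (metis exhaust_5)

lemma tail_swap_nth: "tail_swap x $ 1 = x $ 1" "tail_swap x $ 2 = x $ 2" "tail_swap x $ 3 = x $ 3"
  "tail_swap x $ 4 = x $ 4" "tail_swap x $ 5 = x $ 6" "tail_swap x $ 6 = x $ 5"
  by (simp_all add: tail_swap_def Transposition.transpose_def)

lemma D6_glue_nth:
  "D6_glue 0 $ j = 0"
  "D6_glue 1 $ 1 = 1/2" "D6_glue 1 $ 2 = 1" "D6_glue 1 $ 3 = 3/2"
  "D6_glue 1 $ 4 = 2" "D6_glue 1 $ 5 = 1" "D6_glue 1 $ 6 = 3/2"
  "D6_glue 2 $ 1 = 1" "D6_glue 2 $ 2 = 1" "D6_glue 2 $ 3 = 1"
  "D6_glue 2 $ 4 = 1" "D6_glue 2 $ 5 = 1/2" "D6_glue 2 $ 6 = 1/2"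
  "D6_glue 3 $ 1 = 1/2" "D6_glue 3 $ 2 = 1" "D6_glue 3 $ 3 = 3/2"
  "D6_glue 3 $ 4 = 2" "D6_glue 3 $ 5 = 3/2" "D6_glue 3 $ 6 = 1"
  by (simp_all add: numeral_2_eq_2 numeral_3_eq_3 d_def axis_def)

text \<open>The involution exchanges the classes [1] and [3] and fixes [0] and [2]. The equality
  holds for the chosen representatives themselves, not only modulo D_6.\<close>

lemma tail_swap_glue: "tail_swap (D6_glue n) = D6_glue (Transposition.transpose 1 3 n)"
proof -
  consider "n = 0" | "n = 1" | "n = 2" | "n = 3" | m where "n = Suc (Suc (Suc (Suc m)))"
    by (metis One_nat_def Suc_1 numeral_3_eq_3 not0_implies_Suc)
  then show ?thesis
  proof cases
    \<comment> \<open>Beyond the four glue classes \<open>D6_glue\<close> has the default value 0,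
      which \<open>tail_swap\<close> fixes.\<close>
    case 5
    then have "Transposition.transpose 1 3 n = n" by (simp add: Transposition.transpose_def)
    with 5 show ?thesis by (simp add: vec_eq_iff tail_swap_def)
  qed (simp_all add: Transposition.transpose_def vec_eq_iff forall_6 tail_swap_nth
      D6_glue_nth del: D6_glue.simps One_nat_def)
qed

lemma tail_swap_add: "tail_swap (x + y) = tail_swap x + tail_swap y"
  by (simp add: vec_eq_iff tail_swap_def)

lemma tail_swap_diff: "tail_swap (x - y) = tail_swap x - tail_swap y"
  by (simp add: vec_eq_iff tail_swap_def)

lemma tail_swap_tail_swap: "tail_swap (tail_swap x) = x"
  by (simp add: vec_eq_iff tail_swap_def)

text \<open>Both tails are joined to \<open>d 4\<close> and to nothing else, so exchanging them is a
  symmetry of the Dynkin diagram.\<close>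

lemma D6_form_tail_swap: "D6_form (tail_swap x) (tail_swap y) = D6_form x y"
  by (simp add: D6_form_eq tail_swap_nth)

lemma N_swap_add: "N_swap (x + y) = N_swap x + N_swap y"
  by (simp add: vec_eq_iff[where 'b=4] forall_4 N_swap_def vector_4 tail_swap_add)

lemma N_swap_diff: "N_swap (x - y) = N_swap x - N_swap y"
  by (simp add: vec_eq_iff[where 'b=4] forall_4 N_swap_def vector_4 tail_swap_diff)

lemma N_swap_N_swap: "N_swap (N_swap x) = x"
  by (simp add: vec_eq_iff[where 'b=4] forall_4 N_swap_def vector_4 tail_swap_tail_swap)

lemma D6_4_form_N_swap: "D6_4_form (N_swap x) (N_swap y) = D6_4_form x y"
  by (simp add: D6_4_form_def sum_4 N_swap_def vector_4 D6_form_tail_swap)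

lemma N_swap_glue: "N_swap (vector (map D6_glue [i, j, k, l])) =
   vector (map D6_glue (map (Transposition.transpose 1 3) [i, j, l, k]))"
  by (simp add: N_swap_def vector_4 tail_swap_glue)

section \<open>Invariance of the glue code and of the Niemeier lattice\<close>

lemma permute_list_upto_4:
  assumes "p permutes {..<4::nat}"
  shows "permute_list p [0,1,2,3] = map p [0,1,2,3]"
proof -
  have "[0,1,2,3] = [0..<4]" by (simp add: upt_conv_Cons)
  moreover have "permute_list p [0..<4] = map p [0..<4]"
    using permutes_in_image[OF assms] by (auto simp: permute_list_def)
  ultimately show ?thesis by simp
qed

text \<open>On the word of a permutation \<open>p\<close>, the tail swap composes \<open>p\<close>
  on the left with a transposition of letters, and the exchange of copies composes it on the right
  with a transposition of positions; the two sign changes cancel. On constant words the exchange of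
  copies is invisible and the letters 1 and 3 are exchanged.\<close>

lemma N_swap_glue_code:
  assumes "w \<in> glue_code"
  shows "\<exists>w'\<in>glue_code. N_swap (vector (map D6_glue w)) = vector (map D6_glue w')"
proof -
  let ?t = "Transposition.transpose 1 (3::nat)" and ?u = "Transposition.transpose 2 (3::nat)"
  consider "w \<in> {[0,0,0,0],[1,1,1,1],[2,2,2,2],[3,3,3,3]}"
    | p where "p permutes {..<4}" "evenperm p" "w = permute_list p [0,1,2,3]"
    using assms by (auto simp: glue_code_def)
  then show ?thesis
  proof cases
    case 1
    then obtain n where n: "w = [n, n, n, n]" "n \<in> {0, 1, 2, 3}" by blast
    have "map ?t w \<in> glue_code"
      using n by (auto simp: glue_code_def Transposition.transpose_def)
    then show ?thesis
      using N_swap_glue[of n n n n] n(1) by (intro bexI) simp_all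
  next
    case (2 p)
    \<comment> \<open>\<open>?t\<close> acts on letters. \<open>?u\<close> acts on positions counted
      from 0, so its 2 and 3 stand for the third and fourth copies.\<close>
    let ?q = "?t \<circ> p \<circ> ?u"
    have tu: "?t permutes {..<4}" "?u permutes {..<4}"
      by (auto intro: permutes_swap_id)
    then have q: "?q permutes {..<4}" using 2(1) by (blast intro: permutes_compose)
    have "evenperm ?q"
      using 2(1,2) tu permutes_imp_permutation[OF finite_lessThan]
      by (simp add: evenperm_comp evenperm_swap permutation_compose permutation_swap_id)
    with q have "map ?q [0,1,2,3] \<in> glue_code"
      unfolding glue_code_def permute_list_upto_4[OF q, symmetric] by blast
    moreover have "map ?q [0,1,2,3] = map ?t [p 0, p 1, p 3, p 2]"
      by (simp add: Transposition.transpose_def)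
    moreover have "w = [p 0, p 1, p 2, p 3]"
      using 2(3) permute_list_upto_4[OF 2(1)] by simp
    ultimately show ?thesis
      using N_swap_glue[of "p 0" "p 1" "p 2" "p 3"] by metis
  qed
qed

lemma N_swap_mem:
  assumes "x \<in> N_D6_4"
  shows "N_swap x \<in> N_D6_4"
  using assms unfolding N_D6_4_def
proof (induction rule: group_closure.induct)
  case (base s)
  \<comment> \<open>The base case of \<open>group_closure\<close> also contains 0 beside the given
    generators.\<close>
  have "N_swap 0 = 0" using N_swap_diff[of 0 0] by simp
  moreover have "N_swap s \<in> {x. \<forall>k. x $ k \<in> D6}" if "\<forall>k. s $ k \<in> D6"
    using that by (simp add: forall_4 N_swap_def vector_4 D6_def int_lattice_def tail_swap_def)
  ultimately show ?case
    using base N_swap_glue_code by (intro group_closure.base) auto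
next
  case (diff s t)
  then show ?case by (simp add: N_swap_diff group_closure.diff)
qed

text \<open>Bijectivity on the lattice follows from \<open>N_swap\<close> being an involution that
  maps the lattice into itself.\<close>

lemma N_swap_Aut: "N_swap \<in> lattice_Aut N_D6_4 D6_4_form"
proof -
  have "N_swap ` N_D6_4 = N_D6_4"
  proof
    show "N_swap ` N_D6_4 \<subseteq> N_D6_4" using N_swap_mem by blast
    show "N_D6_4 \<subseteq> N_swap ` N_D6_4" using N_swap_mem N_swap_N_swap by (metis image_eqI subsetI)
  qed
  moreover have "inj_on N_swap N_D6_4"
    by (rule inj_on_inverseI) (rule N_swap_N_swap)
  ultimately show ?thesis
    by (simp add: lattice_Aut_def lattice_embedding_def N_swap_add D6_4_form_N_swap)
qed

section \<open>Integrality conditions on lattice vectors\<close>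

lemma glue_code_words:
  assumes "w \<in> glue_code"
  shows "w \<in> {[0,0,0,0],[1,1,1,1],[2,2,2,2],[3,3,3,3]} \<or> w \<in> even_words"
proof -
  have "permute_list p [0,1,2,3] \<in> even_words" if "p permutes {..<4}" "evenperm p" for p
    using permutes_4_words[OF that(1)] that permute_list_upto_4 by auto
  then show ?thesis using assms by (auto simp: glue_code_def)
qed

text \<open>
  The last two conditions are parity checks of the glue code: each expresses one bit of the class
  in \<open>D\<^sub>6\<^sup>*/D\<^sub>6\<close> of the first or second component through the classes of the last two.
\<close>

lemma N_D6_4_integrality:
  assumes "x \<in> N_D6_4"
  shows "x$1$2 \<in> \<int>" "x$1$4 \<in> \<int>" "x$1$1 + x$1$5 + x$1$6 \<in> \<int>" "x$1$1 + x$1$3 \<in> \<int>"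
    "x$1$5 + x$3$5 + x$3$6 + x$4$6 \<in> \<int>" "x$2$6 + x$3$5 + x$3$6 + x$4$5 \<in> \<int>"
proof -
  \<comment> \<open>The first four conditions involve only the first component and hold for every
    vector of the dual lattice of D_6. All six are additive, so checking them on the generators is
    enough.\<close>
  let ?P = "\<lambda>x :: real ^ 6 ^ 4. x$1$2 \<in> \<int> \<and> x$1$4 \<in> \<int> \<and> x$1$1 + x$1$5 + x$1$6 \<in> \<int> \<and> x$1$1 + x$1$3 \<in> \<int> \<and>
    x$1$5 + x$3$5 + x$3$6 + x$4$6 \<in> \<int> \<and> x$2$6 + x$3$5 + x$3$6 + x$4$5 \<in> \<int>"
  have "?P x"
    using assms unfolding N_D6_4_def
  proof (induction rule: group_closure.induct)
    case (base s)
    have "?P (vector (map D6_glue w))" if "w \<in> glue_code" for w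
      using glue_code_words[OF that] unfolding even_words_def
      by (elim insertE disjE emptyE)
        (simp_all add: vector_4 D6_glue_nth del: D6_glue.simps One_nat_def)
    moreover have "?P s" if "\<forall>k. s $ k \<in> D6"
      using that by (simp add: D6_def int_lattice_def)
    ultimately show ?case using base by auto
  next
    case (diff s t)
    \<comment> \<open>Regrouping turns each condition on \<open>s - t\<close> into a difference of
      the same expressions for \<open>s\<close> and \<open>t\<close>.\<close>
    have lin: "(a - a') + (b - b') = (a + b) - (a' + b')"
      for a a' b b' :: real by simp
    show ?case
      using diff.IH by (simp only: vector_minus_component lin Ints_diff)
  qed
  then show "x$1$2 \<in> \<int>" "x$1$4 \<in> \<int>" "x$1$1 + x$1$5 + x$1$6 \<in> \<int>" "x$1$1 + x$1$3 \<in> \<int>"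
    "x$1$5 + x$3$5 + x$3$6 + x$4$6 \<in> \<int>" "x$2$6 + x$3$5 + x$3$6 + x$4$5 \<in> \<int>" by blast+
qed

section \<open>Primitivity and the conclusion\<close>

text \<open>If a multiple of \<open>x\<close> lies in the image of \<open>f'\<close>, then pulling
  back along \<open>g\<close> puts the same multiple of the preimage of \<open>x\<close> into the
  image of \<open>f\<close>, where primitivity applies.\<close>

lemma primitive_embedding_Aut:
  assumes f: "primitive_embedding L b M c f" and g: "g \<in> lattice_Aut M c"
    and f': "\<And>x. x \<in> L \<Longrightarrow> f' x = g (f x)"
    and L: "\<And>x y. x \<in> L \<Longrightarrow> y \<in> L \<Longrightarrow> x + y \<in> L"
    and M: "0 \<in> M" "\<And>x y. x \<in> M \<Longrightarrow> y \<in> M \<Longrightarrow> x + y \<in> M"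
  shows "primitive_embedding L b M c f'"
proof -
  have fM: "f x \<in> M" if "x \<in> L" for x
    using f that by (auto simp: primitive_embedding_def lattice_embedding_def)
  have g_add: "g (x + y) = g x + g y" if "x \<in> M" "y \<in> M" for x y
    using g that by (auto simp: lattice_Aut_def lattice_embedding_def)
  have inj: "inj_on g M" and surj: "g ` M = M"
    using g by (auto simp: lattice_Aut_def lattice_embedding_def)
  \<comment> \<open>\<open>g\<close> is known to be additive on \<open>M\<close> only, so
    compatibility with multiples is proved by induction, together with their membership in
    \<open>M\<close>.\<close>
  have mult: "real n *\<^sub>R x \<in> M \<and> g (real n *\<^sub>R x) = real n *\<^sub>R g x" if "x \<in> M" for n x
  proof (induction n)
    case 0
    then show ?case using M(1) g_add[of 0 0] by simp
  next
    case (Suc n)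
    have "real (Suc n) *\<^sub>R x = x + real n *\<^sub>R x" for x :: 'b
      by (simp add: scaleR_add_left)
    moreover have "x + real n *\<^sub>R x \<in> M"
      using Suc that M(2) by blast
    moreover have "g (x + real n *\<^sub>R x) = g x + real n *\<^sub>R g x"
      using Suc that g_add by simp
    ultimately show ?case by metis
  qed
  have image: "f' ` L = g ` f ` L"
    unfolding image_image using f' by (rule image_cong[OF refl])
  have "inj_on (g \<circ> f) L"
  proof (rule comp_inj_on)
    show "inj_on f L"
      using f by (auto simp: primitive_embedding_def lattice_embedding_def)
    show "inj_on g (f ` L)"
      using inj fM by (blast intro: inj_on_subset)
  qed
  then have "inj_on f' L"
    using f' by (simp add: inj_on_def)
  have "lattice_embedding L b M c f'"
    unfolding lattice_embedding_def
  proof (intro conjI ballI)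
    show "inj_on f' L" by fact
    show "f' ` L \<subseteq> M" using fM surj unfolding image by (metis image_mono image_subsetI)
    show "f' (x + y) = f' x + f' y" if "x \<in> L" "y \<in> L" for x y
    proof -
      have "f (x + y) = f x + f y"
        using f that unfolding primitive_embedding_def lattice_embedding_def by blast
      then show ?thesis by (simp add: f' L g_add fM that)
    qed
    show "c (f' x) (f' y) = b x y" if "x \<in> L" "y \<in> L" for x y
    proof -
      have "c (f x) (f y) = b x y"
        using f that unfolding primitive_embedding_def lattice_embedding_def by blast
      moreover have "c (g (f x)) (g (f y)) = c (f x) (f y)"
        using g fM that unfolding lattice_Aut_def lattice_embedding_def by blast
      ultimately show ?thesis by (simp add: f' that)
    qed
  qed
  moreover have "x \<in> f' ` L" if "x \<in> M" "n \<noteq> 0" "real n *\<^sub>R x \<in> f' ` L" for x and n :: nat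
  proof -
    have "x \<in> g ` M" using that(1) surj by simp
    then obtain y where y: "y \<in> M" "x = g y" by blast
    from that(3) obtain z where z: "z \<in> L" "real n *\<^sub>R x = g (f z)"
      unfolding image by blast
    have "g (real n *\<^sub>R y) = g (f z)"
      using mult[OF y(1)] y(2) z(2) by simp
    then have "real n *\<^sub>R y = f z"
      by (rule inj_onD[OF inj _ conjunct1[OF mult[OF y(1)]] fM[OF z(1)]])
    then have "real n *\<^sub>R y \<in> f ` L"
      using z(1) by simp
    then have "y \<in> f ` L"
      using f y(1) that(2) unfolding primitive_embedding_def by blast
    then show ?thesis
      unfolding image y(2) by (rule imageI)
  qed
  ultimately show ?thesis unfolding primitive_embedding_def by blast
qed

lemma primitive_i1: "primitive_embedding A5_A1 A5_A1_form N_D6_4 D6_4_form (A5_A1_map i1 (d 6))"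
proof -
  let ?f = "A5_A1_map i1 (d 6)"
  have f_nth: "?f z $ 1 = i1 (fst z)" "?f z $ 2 $ j = (if j = 6 then snd z $ 1 else 0)"
    "?f z $ 3 = 0" "?f z $ 4 = 0" for z j
    by (simp_all add: A5_A1_map_def vector_4 d_def axis_def)
  have eqI: "x = ?f z" if "x $ 1 = i1 (fst z)" "\<And>j. x $ 2 $ j = (if j = 6 then snd z $ 1 else 0)"
     "x $ 3 = 0" "x $ 4 = 0" for x z
    using that f_nth[of z] by (simp add: vec_eq_iff[where 'b=4] forall_4) (simp add: vec_eq_iff)
  have "?f z \<in> N_D6_4" if "z \<in> A5_A1" for z
  proof -
    have "?f z $ k \<in> D6" for k
      using that exhaust_4[of k]
      by (auto simp: f_nth D6_def int_lattice_def forall_6 i1_nth A5_A1_def)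
    then show ?thesis by (auto simp: N_D6_4_def intro: group_closure.base)
  qed
  moreover have "inj ?f"
  proof (rule injI)
    fix y z assume "?f y = ?f z"
    then have "i1 (fst y) = i1 (fst z)" "snd y $ 1 = snd z $ 1"
      by (metis f_nth(1), metis f_nth(2))
    then show "y = z"
      by (auto simp: prod_eq_iff vec_eq_iff forall_5 forall_6 i1_nth forall_1)
  qed
  moreover have "?f (y + z) = ?f y + ?f z" for y z
    by (rule eqI[symmetric]) (simp_all add: f_nth vec_eq_iff forall_6 i1_nth)
  moreover have "D6_4_form (?f y) (?f z) = A5_A1_form y z" for y z
    by (simp add: D6_4_form_def sum_4 f_nth D6_form_eq A5_A1_form_def A5_form_eq A1_form_eq i1_nth)
  moreover have "x \<in> ?f ` A5_A1" if "x \<in> N_D6_4" "n \<noteq> 0" "real n *\<^sub>R x \<in> ?f ` A5_A1" for x and n :: nat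
  proof -
    from that(3) obtain z where z: "real n *\<^sub>R x = ?f z" by blast
    \<comment> \<open>Over the reals, dividing \<open>z\<close> by \<open>n\<close> gives a preimage
      of \<open>x\<close>; it remains to see that its coordinates are integers.\<close>
    define y :: "(real ^ 5) \<times> (real ^ 1)" where "y = (inverse (real n)) *\<^sub>R z"
    have x: "x = inverse (real n) *\<^sub>R ?f z"
      using that(2) by (simp flip: z)
    have xy: "x = ?f y"
      by (rule eqI) (simp_all add: x y_def f_nth vec_eq_iff forall_6 i1_nth)
    \<comment> \<open>The last two components of \<open>x\<close> and the coordinate
      \<open>x$1$6\<close> vanish, so the two parity checks reduce to integrality of
      \<open>x$1$5\<close> and \<open>x$2$6\<close>.\<close>
    have N: "x$1$2 \<in> \<int>" "x$1$4 \<in> \<int>" "x$1$5 \<in> \<int>" "x$2$6 \<in> \<int>" "x$1$1 + x$1$5 \<in> \<int>" "x$1$1 + x$1$3 \<in> \<int>"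
      using N_D6_4_integrality[OF that(1)] by (simp_all add: xy f_nth i1_nth)
    have "x$1$1 \<in> \<int>" using Ints_diff[OF N(5,3)] by simp
    moreover from this have "x$1$3 \<in> \<int>" using Ints_diff[OF N(6)] by simp
    ultimately have "y \<in> A5_A1"
      using N by (auto simp: xy f_nth i1_nth A5_A1_def int_lattice_def mem_Times_iff forall_5 forall_1)
    with xy show ?thesis by blast
  qed
  ultimately show ?thesis
    by (auto simp: primitive_embedding_def lattice_embedding_def intro: inj_on_subset)
qed

text \<open>The tail swap turns \<open>i1\<close> into \<open>i2\<close> and \<open>d 6\<close> into
  \<open>d 5\<close>. Exchanging the last two copies has no effect here, since both components are
  zero.\<close>

lemma N_swap_A5_A1_map: "N_swap (A5_A1_map i1 (d 6) z) = A5_A1_map i2 (d 5) z"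
  by (simp add: N_swap_def A5_A1_map_def vector_4 vec_eq_iff[where 'b=4] forall_4)
     (simp add: vec_eq_iff forall_6 tail_swap_nth i1_nth i2_nth d_def axis_def)

theorem corollary1:
  shows "primitive_embedding A5_A1 A5_A1_form N_D6_4 D6_4_form (A5_A1_map i1 (d 6))
    \<and> primitive_embedding A5_A1 A5_A1_form N_D6_4 D6_4_form (A5_A1_map i2 (d 5))
    \<and> isomorphic_embeddings A5_A1 N_D6_4 D6_4_form
        (A5_A1_map i1 (d 6)) (A5_A1_map i2 (d 5))"
proof (intro conjI)
  \<comment> \<open>The second embedding inherits primitivity from the first along
    \<open>N_swap\<close>.\<close>
  show "primitive_embedding A5_A1 A5_A1_form N_D6_4 D6_4_form (A5_A1_map i2 (d 5))"
  proof (rule primitive_embedding_Aut[OF primitive_i1 N_swap_Aut])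
    show "x + y \<in> A5_A1" if "x \<in> A5_A1" "y \<in> A5_A1" for x y
      using that by (auto simp: A5_A1_def int_lattice_def)
  qed (simp_all add: N_D6_4_def group_closure_add N_swap_A5_A1_map)
  show "isomorphic_embeddings A5_A1 N_D6_4 D6_4_form (A5_A1_map i1 (d 6)) (A5_A1_map i2 (d 5))"
    unfolding isomorphic_embeddings_def using N_swap_Aut N_swap_A5_A1_map by blast
qed (rule primitive_i1)

end
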